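(* Given the data $w^d$ and $w^{\mathrm{ini}}$, an optimal input solution $u^*$ of the unconstrained problem $\min_{u\in\mathbb{R}^{mN}}J(u)$, where $$J(u)=z_{\mathrm{ini}}^TK_p^T\mathcal{Q}K_pz_{\mathrm{ini}}+2z_{\mathrm{ini}}^TK_p^T\mathcal{Q}K_fu+u^T(K_f^T\mathcal{Q}K_f+\mathcal{R})u,$$ satisfies $$(K_f^T\mathcal{Q}K_f+\mathcal{R})u^*+K_f^T\mathcal{Q}^TK_pz_{\mathrm{ini}}=0 .$$
   Context: $w^d=\{u^d_k,y^d_k\}_{k=0}^{T-1}$ is an input-output trajectory of an LTI system with $m$ inputs and $p$ outputs, and $w^{\mathrm{ini}}$ a $T_{\mathrm{ini}}$-length trajectory with stacked inputs and outputs $u^{\mathrm{ini}},y^{\mathrm{ini}}$; $z_{\mathrm{ini}}=\operatorname{col}(u^{\mathrm{ini}},y^{\mathrm{ini}})$. For a signal $v=\{v_k\}_{k=0}^{T-1}$ the Hankel matrix $\mathcal{H}_L(v)$ has $L$ block rows and $T-L+1$ columns, with $(i,j)$ block $v_{i+j}$. Partition $\operatorname{col}(U_p,U_f)=\mathcal{H}_{T_{\mathrm{ini}}+N}(u^d)$, $\operatorname{col}(Y_p,Y_f)=\mathcal{H}_{T_{\mathrm{ini}}+N}(y^d)$, with $U_p,Y_p$ the first $T_{\mathrm{ini}}$ and $U_f,Y_f$ the last $N$ block rows. $(K_p\mid K_f)=Y_f\operatorname{col}(U_p,Y_p,U_f)^\dagger$, where $K_p$ has $(m+p)T_{\mathrm{ini}}$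 columns, $K_f$ has $mN$ columns and $\dagger$ is the Moore-Penrose pseudoinverse. $\mathcal{Q}=\operatorname{diag}(Q,\dots,Q)$, $\mathcal{R}=\operatorname{diag}(R,\dots,R)$ ($N$ blocks each) with $Q\in\mathbb{S}^p$, $R\in\mathbb{S}^m$ positive definite. *)

theory Defs
  imports Complex_Main "Jordan_Normal_Form.Matrix"
begin

section \<open>Trajectories of linear time-invariant systems\<close>

text \<open>A finite signal is a function on \<open>nat\<close> of which only the first \<open>T\<close> samples are relevant.
  The state-space system has \<open>n\<close> states, \<open>m\<close> inputs and \<open>p\<close> outputs.\<close>

definition is_lti_system ::
  "nat \<Rightarrow> nat \<Rightarrow> nat \<Rightarrow> real mat \<Rightarrow> real mat \<Rightarrow> real mat \<Rightarrow> real mat \<Rightarrow> bool" where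
  "is_lti_system n m p A B C D \<longleftrightarrow>
     A \<in> carrier_mat n n \<and> B \<in> carrier_mat n m \<and> C \<in> carrier_mat p n \<and> D \<in> carrier_mat p m"

definition is_io_trajectory ::
  "real mat \<Rightarrow> real mat \<Rightarrow> real mat \<Rightarrow> real mat \<Rightarrow> nat \<Rightarrow>
   (nat \<Rightarrow> real vec) \<Rightarrow> (nat \<Rightarrow> real vec) \<Rightarrow> bool" where
  "is_io_trajectory A B C D T u y \<longleftrightarrow>
     (\<exists>x. x 0 \<in> carrier_vec (dim_row A) \<and>
       (\<forall>k<T. u k \<in> carrier_vec (dim_col B) \<and>
              x (Suc k) = A *\<^sub>v x k + B *\<^sub>v u k \<and>
              y k = C *\<^sub>v x k + D *\<^sub>v u k))"

section \<open>Stacked signals and Hankel matrices\<close>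

definition stack_signal :: "nat \<Rightarrow> nat \<Rightarrow> (nat \<Rightarrow> real vec) \<Rightarrow> real vec" where
  "stack_signal q L v = vec (q * L) (\<lambda>i. v (i div q) $ (i mod q))"

text \<open>Block Hankel matrix with \<open>L\<close> block rows of a \<open>q\<close>-dimensional signal of length \<open>T\<close>.
  The number of columns is meaningful only for \<open>L \<le> T\<close>.\<close>

definition hankel :: "nat \<Rightarrow> nat \<Rightarrow> nat \<Rightarrow> (nat \<Rightarrow> real vec) \<Rightarrow> real mat" where
  "hankel q L T v = mat (q * L) (T - L + 1) (\<lambda>(i, j). v (i div q + j) $ (i mod q))"

definition append_cols :: "'a :: zero mat \<Rightarrow> 'a mat \<Rightarrow> 'a mat" (infixr \<open>@\<^sub>c\<close> 65) where
  "A @\<^sub>c B = four_block_mat A B (0\<^sub>m 0 (dim_col A)) (0\<^sub>m 0 (dim_col B))"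

lemma append_cols_carrier:
  "A \<in> carrier_mat nr nc1 \<Longrightarrow> B \<in> carrier_mat nr nc2 \<Longrightarrow> A @\<^sub>c B \<in> carrier_mat nr (nc1 + nc2)"
  unfolding append_cols_def by auto

section \<open>Weights\<close>

definition sym_pos_def :: "nat \<Rightarrow> real mat \<Rightarrow> bool" where
  "sym_pos_def n M \<longleftrightarrow> M \<in> carrier_mat n n \<and> M\<^sup>T = M \<and>
     (\<forall>x \<in> carrier_vec n. x \<noteq> 0\<^sub>v n \<longrightarrow> x \<bullet> (M *\<^sub>v x) > 0)"

section \<open>The Moore-Penrose pseudoinverse\<close>

definition is_pinv :: "real mat \<Rightarrow> real mat \<Rightarrow> bool" where
  "is_pinv A X \<longleftrightarrow> X \<in> carrier_mat (dim_col A) (dim_row A) \<and>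
     A * X * A = A \<and> X * A * X = X \<and> (A * X)\<^sup>T = A * X \<and> (X * A)\<^sup>T = X * A"

definition pinv :: "real mat \<Rightarrow> real mat" where
  "pinv A = (THE X. is_pinv A X)"

text \<open>The remaining lemmas show that \<open>pinv\<close> is well defined.\<close>

lemma is_pinv_unique:
  assumes X: "is_pinv A X" and Y: "is_pinv A Y"
  shows "X = Y"
proof -
  let ?m = "dim_row A" and ?n = "dim_col A"
  have [simp]: "dim_row X = ?n" "dim_col X = ?m" "dim_row Y = ?n" "dim_col Y = ?m"
    using X Y by (auto simp: is_pinv_def)
  have AXAY: "A * X = A * Y"
  proof -
    have "A * X = (A * X)\<^sup>T" using X by (simp add: is_pinv_def)
    also have "\<dots> = ((A * Y) * (A * X))\<^sup>T"
    proof -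
      have "(A * Y) * (A * X) = (A * Y * A) * X"
        by (rule assoc_mult_mat[symmetric, of _ ?m ?m _ ?n _ ?m]) (auto intro!: carrier_matI)
      then show ?thesis using Y by (simp add: is_pinv_def)
    qed
    also have "\<dots> = (A * X)\<^sup>T * (A * Y)\<^sup>T"
      by (rule transpose_mult[of _ ?m ?m _ ?m]) (auto intro!: carrier_matI)
    also have "\<dots> = (A * X) * (A * Y)" using X Y by (simp add: is_pinv_def)
    also have "\<dots> = (A * X * A) * Y"
      by (rule assoc_mult_mat[symmetric, of _ ?m ?m _ ?n _ ?m]) (auto intro!: carrier_matI)
    also have "\<dots> = A * Y" using X by (simp add: is_pinv_def)
    finally show ?thesis .
  qed
  have XAYA: "X * A = Y * A"
  proof -
    have "X * A = (X * A)\<^sup>T" using X by (simp add: is_pinv_def)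
    also have "\<dots> = ((X * A) * (Y * A))\<^sup>T"
    proof -
      have "(X * A) * (Y * A) = X * (A * (Y * A))"
        by (rule assoc_mult_mat[of _ ?n ?m _ ?n _ ?n]) (auto intro!: carrier_matI)
      also have "A * (Y * A) = A * Y * A"
        by (rule assoc_mult_mat[symmetric, of _ ?m ?n _ ?m _ ?n]) (auto intro!: carrier_matI)
      finally show ?thesis using Y by (simp add: is_pinv_def)
    qed
    also have "\<dots> = (Y * A)\<^sup>T * (X * A)\<^sup>T"
      by (rule transpose_mult[of _ ?n ?n _ ?n]) (auto intro!: carrier_matI)
    also have "\<dots> = (Y * A) * (X * A)" using X Y by (simp add: is_pinv_def)
    also have "\<dots> = Y * (A * (X * A))"
      by (rule assoc_mult_mat[of _ ?n ?m _ ?n _ ?n]) (auto intro!: carrier_matI)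
    also have "A * (X * A) = A * X * A"
      by (rule assoc_mult_mat[symmetric, of _ ?m ?n _ ?m _ ?n]) (auto intro!: carrier_matI)
    also have "A * X * A = A" using X by (simp add: is_pinv_def)
    finally show ?thesis .
  qed
  have "X = X * A * X" using X by (simp add: is_pinv_def)
  also have "\<dots> = Y * A * X" by (simp only: XAYA)
  also have "\<dots> = Y * (A * X)"
    by (rule assoc_mult_mat[of _ ?n ?m _ ?n _ ?m]) (auto intro!: carrier_matI)
  also have "\<dots> = Y * A * Y" unfolding AXAY
    by (rule assoc_mult_mat[symmetric, of _ ?n ?m _ ?n _ ?m]) (auto intro!: carrier_matI)
  also have "\<dots> = Y" using Y by (simp add: is_pinv_def)
  finally show ?thesis .
qed

lemma regular_step:
  fixes A :: "real mat"
  assumes [simp]: "A \<in> carrier_mat m n" "Y \<in> carrier_mat n m" "X \<in> carrier_mat n m"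
    and X: "(A - A * Y * A) * X * (A - A * Y * A) = A - A * Y * A"
  shows "A * (Y + (1\<^sub>m n - Y * A) * X * (1\<^sub>m m - A * Y)) * A = A"
proof -
  note [simp] = assms(1-3)[THEN carrier_matD(1)] assms(1-3)[THEN carrier_matD(2)]
  let ?L = "1\<^sub>m n - Y * A" and ?R = "1\<^sub>m m - A * Y"
  have [simp]: "?L \<in> carrier_mat n n" "?R \<in> carrier_mat m m" "A * Y \<in> carrier_mat m m"
    "Y * A \<in> carrier_mat n n" "A * ?L \<in> carrier_mat m n" "?R * A \<in> carrier_mat m n"
    "?L * X \<in> carrier_mat n m" "?L * X * ?R \<in> carrier_mat n m" "A * Y * A \<in> carrier_mat m n"
    by (auto intro!: carrier_matI)
  have AL: "A * ?L = A - A * Y * A"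
    by (subst mult_minus_distrib_mat[of _ m n _ n]) (auto intro!: carrier_matI simp: assoc_mult_mat[of _ m n _ m _ n])
  have RA: "?R * A = A - A * Y * A"
    by (subst minus_mult_distrib_mat[of _ m m _ _ n]) (auto intro!: carrier_matI)
  have "A * (?L * X * ?R) * A = A * ?L * X * (?R * A)"
  proof -
    have "A * (?L * X * ?R) = A * (?L * X) * ?R"
      by (rule assoc_mult_mat[symmetric, of _ m n _ m _ m]) (auto intro!: carrier_matI)
    also have "A * (?L * X) = A * ?L * X"
      by (rule assoc_mult_mat[symmetric, of _ m n _ n _ m]) (auto intro!: carrier_matI)
    finally have "A * (?L * X * ?R) * A = A * ?L * X * ?R * A" by simp
    also have "\<dots> = A * ?L * X * (?R * A)"
      by (rule assoc_mult_mat[of _ m m _ m _ n])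
        (auto intro!: carrier_matI)
    finally show ?thesis .
  qed
  also have "\<dots> = A - A * Y * A" unfolding AL RA by (rule X)
  finally have *: "A * (?L * X * ?R) * A = A - A * Y * A" .
  have "A * (Y + ?L * X * ?R) * A = (A * Y + A * (?L * X * ?R)) * A"
    by (subst mult_add_distrib_mat[of _ m n _ m]) (auto intro!: carrier_matI)
  also have "\<dots> = A * Y * A + A * (?L * X * ?R) * A"
    by (rule add_mult_distrib_mat[of _ m m _ _ n])
      (auto intro!: carrier_matI)
  also have "\<dots> = A" unfolding * by (intro eq_matI) auto
  finally show ?thesis .
qed

lemma regular_mat:
  fixes A :: "real mat"
  assumes "A \<in> carrier_mat m n"
  shows "\<exists>X \<in> carrier_mat n m. A * X * A = A"
  using assms
proof (induction "card {i. i < m \<and> (\<exists>j<n. A $$ (i, j) \<noteq> 0)}" arbitrary: A rule: less_induct)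
  case (less A)
  note A[simp] = \<open>A \<in> carrier_mat m n\<close>
  note [simp] = carrier_matD[OF A]
  show ?case
  proof (cases "\<exists>i<m. \<exists>j<n. A $$ (i, j) \<noteq> 0")
    case False
    then have "A = 0\<^sub>m m n" using A by (intro eq_matI) auto
    then show ?thesis by (intro bexI[of _ "0\<^sub>m n m"]) (auto intro!: carrier_matI)
  next
    case True
    then obtain i j where i: "i < m" and j: "j < n" and a: "A $$ (i, j) \<noteq> 0" by auto
    define Y where "Y = mat n m (\<lambda>(k, l). if k = j \<and> l = i then 1 / A $$ (i, j) else 0)"
    have Y[simp]: "Y \<in> carrier_mat n m" by (simp add: Y_def)
    note [simp] = carrier_matD[OF Y]
    have AY: "(A * Y) $$ (r, l) = (if l = i then A $$ (r, j) / A $$ (i, j) else 0)"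
      if "r < m" "l < m" for r l
    proof -
      have "(A * Y) $$ (r, l) = (\<Sum>k<n. A $$ (r, k) * Y $$ (k, l))"
        using that by (auto simp: scalar_prod_def lessThan_atLeast0)
      also have "\<dots> = (\<Sum>k<n. if k = j then (if l = i then A $$ (r, k) / A $$ (i, j) else 0) else 0)"
        using that by (intro sum.cong) (auto simp: Y_def)
      finally show ?thesis using j by simp
    qed
    have AYA: "(A * Y * A) $$ (r, c) = A $$ (r, j) / A $$ (i, j) * A $$ (i, c)"
      if "r < m" "c < n" for r c
    proof -
      have "(A * Y * A) $$ (r, c) = (\<Sum>k<m. (A * Y) $$ (r, k) * A $$ (k, c))"
        using that by (auto simp: scalar_prod_def lessThan_atLeast0 simp del: assoc_mult_mat)
      also have "\<dots> = (\<Sum>k<m. if k = i then A $$ (r, j) / A $$ (i, j) * A $$ (k, c) else 0)"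
        using that by (intro sum.cong) (auto simp: AY simp del: index_mult_mat)
      finally show ?thesis using i by simp
    qed
    define B where "B = A - A * Y * A"
    have B[simp]: "B \<in> carrier_mat m n" by (auto simp: B_def intro!: carrier_matI)
    have Bix: "B $$ (r, c) = A $$ (r, c) - A $$ (r, j) / A $$ (i, j) * A $$ (i, c)"
      if "r < m" "c < n" for r c
      using that A Y AYA[OF that] by (auto simp: B_def carrier_matD simp del: assoc_mult_mat)
    have "card {i. i < m \<and> (\<exists>j<n. B $$ (i, j) \<noteq> 0)} < card {i. i < m \<and> (\<exists>j<n. A $$ (i, j) \<noteq> 0)}"
    proof (rule psubset_card_mono)
      have "{i. i < m \<and> (\<exists>j<n. B $$ (i, j) \<noteq> 0)} \<subseteq> {i. i < m \<and> (\<exists>j<n. A $$ (i, j) \<noteq> 0)}"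
      proof safe
        fix k c assume "k < m" "c < n" "B $$ (k, c) \<noteq> 0"
        then have "A $$ (k, c) \<noteq> 0 \<or> A $$ (k, j) \<noteq> 0" by (auto simp: Bix)
        then show "\<exists>j<n. A $$ (k, j) \<noteq> 0" using j \<open>c < n\<close> by blast
      qed
      moreover have "i \<in> {i. i < m \<and> (\<exists>j<n. A $$ (i, j) \<noteq> 0)}" using i j a by auto
      moreover have "i \<notin> {i. i < m \<and> (\<exists>j<n. B $$ (i, j) \<noteq> 0)}" using i a by (auto simp: Bix)
      ultimately show "{i. i < m \<and> (\<exists>j<n. B $$ (i, j) \<noteq> 0)} \<subset> {i. i < m \<and> (\<exists>j<n. A $$ (i, j) \<noteq> 0)}"
        by blast
    qed simp
    from less.hyps[OF this B] obtain X where X: "X \<in> carrier_mat n m" and "B * X * B = B" by blast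
    then have "A * (Y + (1\<^sub>m n - Y * A) * X * (1\<^sub>m m - A * Y)) * A = A"
      unfolding B_def by (intro regular_step) auto
    moreover have "Y + (1\<^sub>m n - Y * A) * X * (1\<^sub>m m - A * Y) \<in> carrier_mat n m"
      using X Y by (auto intro!: carrier_matI simp: carrier_matD)
    ultimately show ?thesis by blast
  qed
qed

lemma transpose_mult_self_eq_0:
  fixes B :: "real mat"
  assumes B: "B \<in> carrier_mat m n" and 0: "B\<^sup>T * B = 0\<^sub>m n n"
  shows "B = 0\<^sub>m m n"
proof (rule eq_matI)
  fix i j assume ij: "i < dim_row (0\<^sub>m m n :: real mat)" "j < dim_col (0\<^sub>m m n :: real mat)"
  have "(\<Sum>k<m. B $$ (k, j) * B $$ (k, j)) = (B\<^sup>T * B) $$ (j, j)"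
    using ij B by (auto simp: scalar_prod_def lessThan_atLeast0)
  also have "\<dots> = 0" unfolding 0 using ij by simp
  finally have "\<forall>k\<in>{..<m}. B $$ (k, j) * B $$ (k, j) = 0"
    by (subst (asm) sum_nonneg_eq_0_iff) auto
  then show "B $$ (i, j) = 0\<^sub>m m n $$ (i, j)" using ij by auto
qed (use B in auto)

text \<open>A least-squares inverse, obtained from a generalized inverse of the Gram matrix.\<close>

lemma least_squares_inverse:
  fixes A :: "real mat"
  assumes A[simp]: "A \<in> carrier_mat m n"
  shows "\<exists>X \<in> carrier_mat n m. A * X * A = A \<and> (A * X)\<^sup>T = A * X"
proof -
  let ?G = "A\<^sup>T * A"
  note [simp] = carrier_matD[OF A]
  have At[simp]: "A\<^sup>T \<in> carrier_mat n m" by simp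
  have G: "?G \<in> carrier_mat n n" by (auto intro!: carrier_matI)
  from regular_mat[OF G] obtain S where S[simp]: "S \<in> carrier_mat n n" and GSG: "?G * S * ?G = ?G"
    by blast
  define X where "X = S * A\<^sup>T"
  have X[simp]: "X \<in> carrier_mat n m" unfolding X_def by (rule mult_carrier_mat[OF S At])
  note [simp] = carrier_matD[OF X]
  have AX[simp]: "A * X \<in> carrier_mat m m" and AXA[simp]: "A * X * A \<in> carrier_mat m n"
    by (auto intro!: carrier_matI)
  define B where "B = A * X * A - A"
  have B[simp]: "B \<in> carrier_mat m n" by (auto simp: B_def intro!: carrier_matI)
  have AtB: "A\<^sup>T * B = 0\<^sub>m n n"
  proof -
    have XA: "X * A \<in> carrier_mat n n" by (rule mult_carrier_mat[OF X A])
    have "A\<^sup>T * (A * X * A) = A\<^sup>T * (A * (X * A))"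
      by (simp only: assoc_mult_mat[OF A X A])
    also have "\<dots> = ?G * (X * A)" by (rule assoc_mult_mat[OF At A XA, symmetric])
    also have "X * A = S * ?G" unfolding X_def by (rule assoc_mult_mat[OF S At A])
    also have "?G * (S * ?G) = ?G * S * ?G" by (rule assoc_mult_mat[OF G S G, symmetric])
    finally have "A\<^sup>T * (A * X * A) = ?G * S * ?G" .
    then show ?thesis unfolding B_def GSG
      by (subst mult_minus_distrib_mat[of _ n m _ n]) (auto intro!: carrier_matI)
  qed
  have "B\<^sup>T * B = 0\<^sub>m n n"
  proof -
    have XA: "X * A \<in> carrier_mat n n" by (rule mult_carrier_mat[OF X A])
    then have XAt: "(X * A)\<^sup>T \<in> carrier_mat n n" by simp
    have XAtAt: "(X * A)\<^sup>T * A\<^sup>T \<in> carrier_mat n m" by (rule mult_carrier_mat[OF XAt At])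
    have "B\<^sup>T = (A * (X * A))\<^sup>T - A\<^sup>T"
      unfolding B_def transpose_minus[OF AXA A] by (simp only: assoc_mult_mat[OF A X A])
    also have "(A * (X * A))\<^sup>T = (X * A)\<^sup>T * A\<^sup>T" by (rule transpose_mult[OF A XA])
    finally have "B\<^sup>T * B = (X * A)\<^sup>T * A\<^sup>T * B - A\<^sup>T * B"
      by (simp only: minus_mult_distrib_mat[OF XAtAt At B])
    also have "(X * A)\<^sup>T * A\<^sup>T * B = (X * A)\<^sup>T * (A\<^sup>T * B)" by (rule assoc_mult_mat[OF XAt At B])
    finally show ?thesis unfolding AtB by (simp only: right_mult_zero_mat[OF XAt]) simp
  qed
  from transpose_mult_self_eq_0[OF B this] have B0: "A * X * A - A = 0\<^sub>m m n" by (simp add: B_def)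
  have AXA_eq: "A * X * A = A"
  proof (rule eq_matI)
    fix i j assume ij: "i < dim_row A" "j < dim_col A"
    then have "(A * X * A - A) $$ (i, j) = 0" unfolding B0 using A by auto
    then show "(A * X * A) $$ (i, j) = A $$ (i, j)" using ij by (subst (asm) index_minus_mat) auto
  qed (auto simp: carrier_matD[OF AXA] carrier_matD[OF A])
  have AXt: "(A * X)\<^sup>T \<in> carrier_mat m m" by simp
  have "A\<^sup>T = (A * X * A)\<^sup>T" using AXA_eq by simp
  also have "\<dots> = A\<^sup>T * (A * X)\<^sup>T" by (rule transpose_mult[OF AX A])
  finally have At_eq: "A\<^sup>T * (A * X)\<^sup>T = A\<^sup>T" ..
  have AS: "A * S \<in> carrier_mat m n" by (rule mult_carrier_mat[OF A S])
  have AX_eq: "A * X = A * S * A\<^sup>T" unfolding X_def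
    by (rule assoc_mult_mat[OF A S At, symmetric])
  have "A * X * (A * X)\<^sup>T = A * S * (A\<^sup>T * (A * X)\<^sup>T)"
    by (subst (1) AX_eq) (rule assoc_mult_mat[OF AS At AXt])
  then have P: "A * X = A * X * (A * X)\<^sup>T" unfolding At_eq AX_eq[symmetric] ..
  have "(A * X)\<^sup>T = (A * X * (A * X)\<^sup>T)\<^sup>T" using P by simp
  also have "\<dots> = A * X * (A * X)\<^sup>T" by (subst transpose_mult[OF AX AXt]) simp
  also have "\<dots> = A * X" using P by simp
  finally show ?thesis using AXA_eq X by blast
qed

lemma ex_is_pinv: "\<exists>X. is_pinv A X"
proof -
  let ?m = "dim_row A" and ?n = "dim_col A"
  have A: "A \<in> carrier_mat ?m ?n" by simp
  from least_squares_inverse[OF A] obtain Y where Y: "Y \<in> carrier_mat ?n ?m"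
    and AYA: "A * Y * A = A" and AYt: "(A * Y)\<^sup>T = A * Y" by blast
  have At: "A\<^sup>T \<in> carrier_mat ?n ?m" by simp
  from least_squares_inverse[OF At] obtain W where W: "W \<in> carrier_mat ?m ?n"
    and AWA: "A\<^sup>T * W * A\<^sup>T = A\<^sup>T" and AWt: "(A\<^sup>T * W)\<^sup>T = A\<^sup>T * W" by blast
  define Z where "Z = W\<^sup>T"
  have Z: "Z \<in> carrier_mat ?n ?m" using W by (simp add: Z_def)
  have ZA_eq: "Z * A = A\<^sup>T * W"
    using AWt transpose_mult[OF At W] by (simp add: Z_def)
  have ZAt: "(Z * A)\<^sup>T = Z * A" using AWt ZA_eq by simp
  have ZA: "Z * A \<in> carrier_mat ?n ?n" by (rule mult_carrier_mat[OF Z A])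
  have AY: "A * Y \<in> carrier_mat ?m ?m" by (rule mult_carrier_mat[OF A Y])
  have "A = (A\<^sup>T * W * A\<^sup>T)\<^sup>T" unfolding AWA by simp
  also have "\<dots> = A * (Z * A)"
    using transpose_mult[OF mult_carrier_mat[OF At W] At] AWt ZA_eq by simp
  finally have AZA: "A * (Z * A) = A" ..
  define X where "X = Z * A * Y"
  have X: "X \<in> carrier_mat ?n ?m" unfolding X_def by (rule mult_carrier_mat[OF ZA Y])
  have AX: "A * X = A * Y"
    using assoc_mult_mat[OF A ZA Y] AZA by (simp add: X_def)
  have XA: "X * A = Z * A"
    using assoc_mult_mat[OF ZA Y A] assoc_mult_mat[OF Z A mult_carrier_mat[OF Y A]]
      assoc_mult_mat[OF A Y A] AYA by (simp add: X_def)
  have "X * A * X = Z * (A * X)"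
    by (simp only: XA assoc_mult_mat[OF Z A X])
  also have "\<dots> = X" unfolding AX unfolding X_def by (rule assoc_mult_mat[OF Z A Y, symmetric])
  finally have "X * A * X = X" .
  moreover have "A * X * A = A" unfolding AX by (rule AYA)
  ultimately have "is_pinv A X"
    using X AYt ZAt by (simp add: is_pinv_def AX XA)
  then show ?thesis ..
qed

lemma is_pinv_pinv: "is_pinv A (pinv A)"
  unfolding pinv_def using ex_is_pinv is_pinv_unique by (metis theI')

lemma pinv_carrier: "A \<in> carrier_mat m n \<Longrightarrow> pinv A \<in> carrier_mat n m"
  using is_pinv_pinv[of A] by (auto simp: is_pinv_def)

end

theory Submission
  imports Defs
begin

text \<open>
  The cost is a quadratic polynomial \<open>c + 2 * (g \<bullet> u) + u \<bullet> (M *\<^sub>v u)\<close> in \<open>u\<close>, whose gradient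
  is twice \<open>M *\<^sub>v u + g\<close> when \<open>M\<close> is symmetric. The gradient vanishes at a minimizer, which can be
  seen without calculus: moving from the minimizer along the residual \<open>r = M *\<^sub>v u + g\<close> with
  step \<open>t\<close> changes the cost by exactly \<open>2 * t * (r \<bullet> r) + t\<^sup>2 * (r \<bullet> (M *\<^sub>v r))\<close>, and this is
  nonnegative for every \<open>t\<close>, also for small negative ones, only if \<open>r \<bullet> r = 0\<close>
  (lemma \<open>quadratic_minimizer_stationary\<close>).

  For the cost at hand, \<open>M = Kf\<^sup>T * QQ * Kf + RR\<close> is symmetric because the weights are, and moving
  the matrix of the linear term to the other side of the inner product gives
  \<open>g = (Kf\<^sup>T * QQ\<^sup>T * Kp) *\<^sub>v zini\<close>.
\<close>

lemma linear_coeff_zero_if_quadratic_nonneg: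
  fixes a b :: real
  assumes nonneg: "\<And>t. 0 \<le> 2 * t * a + t\<^sup>2 * b"
  shows "a = 0"
proof (rule ccontr)
  assume "a \<noteq> 0"
  then have a2: "a\<^sup>2 > 0" by simp
  define s where "s = \<bar>b\<bar> + 1"
  have s: "s > 0" "b < 2 * s" by (auto simp: s_def)
  \<comment> \<open>The step is opposite in sign to \<open>a\<close>, and so short that the linear term dominates.\<close>
  have "0 \<le> 2 * (- a / s) * a + (- a / s)\<^sup>2 * b" by (rule nonneg)
  also have "\<dots> = a\<^sup>2 * (b - 2 * s) / s\<^sup>2"
    using s by (simp add: field_simps power2_eq_square)
  also have "\<dots> < 0"
    using a2 s by (intro divide_neg_pos mult_pos_neg) auto
  finally show False by simp
qed

lemma scalar_prod_self_eq_0_imp: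
  fixes v :: "real vec"
  assumes v: "v \<in> carrier_vec k" and 0: "v \<bullet> v = 0"
  shows "v = 0\<^sub>v k"
proof (rule eq_vecI)
  fix i assume i: "i < dim_vec (0\<^sub>v k :: real vec)"
  have "(\<Sum>j<k. v $ j * v $ j) = 0"
    using v 0 by (simp add: scalar_prod_def lessThan_atLeast0)
  then have "\<forall>j\<in>{..<k}. v $ j * v $ j = 0"
    by (subst (asm) sum_nonneg_eq_0_iff) auto
  then show "v $ i = 0\<^sub>v k $ i" using i by auto
qed (use v in auto)

text \<open>The exact second-order Taylor expansion of a quadratic along the line through \<open>u\<close> in
  direction \<open>d\<close>; symmetry of \<open>M\<close> merges the two mixed terms into one.\<close>

lemma quadratic_along_line:
  fixes M :: "real mat"
  assumes M: "M \<in> carrier_mat k k" and sym: "M\<^sup>T = M"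
    and g: "g \<in> carrier_vec k" and u: "u \<in> carrier_vec k" and d: "d \<in> carrier_vec k"
  shows "2 * (g \<bullet> (u + t \<cdot>\<^sub>v d)) + (u + t \<cdot>\<^sub>v d) \<bullet> (M *\<^sub>v (u + t \<cdot>\<^sub>v d)) =
    2 * (g \<bullet> u) + u \<bullet> (M *\<^sub>v u) + (2 * t * ((M *\<^sub>v u + g) \<bullet> d) + t\<^sup>2 * (d \<bullet> (M *\<^sub>v d)))"
proof -
  have td: "t \<cdot>\<^sub>v d \<in> carrier_vec k" using d by simp
  have Mu: "M *\<^sub>v u \<in> carrier_vec k" and Md: "M *\<^sub>v d \<in> carrier_vec k"
    using M u d by auto
  have tMd: "t \<cdot>\<^sub>v (M *\<^sub>v d) \<in> carrier_vec k" using Md by simp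
  have M_line: "M *\<^sub>v (u + t \<cdot>\<^sub>v d) = M *\<^sub>v u + t \<cdot>\<^sub>v (M *\<^sub>v d)"
    by (simp only: mult_add_distrib_mat_vec[OF M u td] mult_mat_vec[OF M d])
  have mixed: "u \<bullet> (M *\<^sub>v d) = (M *\<^sub>v u) \<bullet> d"
    using transpose_vec_mult_scalar[OF M d u] sym by simp
  have "(u + t \<cdot>\<^sub>v d) \<bullet> (M *\<^sub>v (u + t \<cdot>\<^sub>v d)) =
      u \<bullet> (M *\<^sub>v u) + t * (u \<bullet> (M *\<^sub>v d)) + (t * (d \<bullet> (M *\<^sub>v u)) + t * (t * (d \<bullet> (M *\<^sub>v d))))"
    unfolding M_line add_scalar_prod_distrib[OF u td add_carrier_vec[OF Mu tMd]]
      scalar_prod_add_distrib[OF u Mu tMd] scalar_prod_add_distrib[OF td Mu tMd]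
    using u d Mu Md tMd by simp
  moreover have "d \<bullet> (M *\<^sub>v u) = (M *\<^sub>v u) \<bullet> d" by (rule comm_scalar_prod[OF d Mu])
  moreover have "g \<bullet> (u + t \<cdot>\<^sub>v d) = g \<bullet> u + t * (g \<bullet> d)"
    unfolding scalar_prod_add_distrib[OF g u td] using g d by simp
  moreover have "(M *\<^sub>v u + g) \<bullet> d = (M *\<^sub>v u) \<bullet> d + g \<bullet> d"
    by (rule add_scalar_prod_distrib[OF Mu g d])
  ultimately show ?thesis
    by (simp add: mixed algebra_simps power2_eq_square)
qed

text \<open>Taking the residual itself as the direction makes the first-order term \<open>2 * t * (r \<bullet> r)\<close>, so
  that its vanishing already forces the whole residual to vanish.\<close>

lemma quadratic_minimizer_stationary:
  fixes M :: "real mat"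
  assumes M: "M \<in> carrier_mat k k" and sym: "M\<^sup>T = M" and g: "g \<in> carrier_vec k"
    and J: "\<And>u. u \<in> carrier_vec k \<Longrightarrow> J u = c + 2 * (g \<bullet> u) + u \<bullet> (M *\<^sub>v u)"
    and opt: "is_arg_min J (\<lambda>u. u \<in> carrier_vec k) u"
  shows "M *\<^sub>v u + g = 0\<^sub>v k"
proof -
  have u: "u \<in> carrier_vec k" and min: "\<And>v. v \<in> carrier_vec k \<Longrightarrow> J u \<le> J v"
    using opt by (auto simp: is_arg_min_linorder)
  define r where "r = M *\<^sub>v u + g"
  have r: "r \<in> carrier_vec k" unfolding r_def using M u g by simp
  have "0 \<le> 2 * t * (r \<bullet> r) + t\<^sup>2 * (r \<bullet> (M *\<^sub>v r))" for t
  proof -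
    have v: "u + t \<cdot>\<^sub>v r \<in> carrier_vec k" using u r by simp
    show ?thesis
      using min[OF v] quadratic_along_line[OF M sym g u r, of t, folded r_def]
      by (simp add: J[OF u] J[OF v])
  qed
  then have "r \<bullet> r = 0" by (rule linear_coeff_zero_if_quadratic_nonneg)
  then show ?thesis using scalar_prod_self_eq_0_imp[OF r] by (simp add: r_def)
qed

lemma diag_block_mat_replicate_carrier:
  assumes "S \<in> carrier_mat k k"
  shows "diag_block_mat (replicate N S) \<in> carrier_mat (k * N) (k * N)"
  using assms
  by (intro carrier_matI) (auto simp: dim_diag_block_mat sum_list_replicate)

lemma diag_block_mat_symmetric:
  fixes Ss :: "'a :: zero mat list"
  assumes "\<And>S. S \<in> set Ss \<Longrightarrow> S\<^sup>T = S"
  shows "(diag_block_mat Ss)\<^sup>T = diag_block_mat Ss"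
  using assms
proof (induction Ss)
  case (Cons S Ss)
  let ?D = "diag_block_mat Ss"
  have S: "S\<^sup>T = S" and D: "?D\<^sup>T = ?D" using Cons by auto
  have "dim_col S = dim_row S" "dim_col ?D = dim_row ?D"
    using arg_cong[OF S, of dim_row] arg_cong[OF D, of dim_row] by simp_all
  then have "S \<in> carrier_mat (dim_row S) (dim_row S)" "?D \<in> carrier_mat (dim_row ?D) (dim_row ?D)"
    and dims: "dim_col S = dim_row S" "dim_col ?D = dim_row ?D"
    by auto
  from transpose_four_block_mat[OF this(1) zero_carrier_mat zero_carrier_mat this(2)]
  show ?case by (simp only: diag_block_mat.simps Let_def dims S D zero_transpose_mat)
qed simp

lemma congruence_symmetric:
  fixes S :: "'a :: comm_semiring_0 mat"
  assumes S: "S \<in> carrier_mat k k" and sym: "S\<^sup>T = S" and F: "F \<in> carrier_mat k l"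
  shows "(F\<^sup>T * S * F)\<^sup>T = F\<^sup>T * S * F"
proof -
  have Ft: "F\<^sup>T \<in> carrier_mat l k" using F by simp
  have "(F\<^sup>T * S * F)\<^sup>T = F\<^sup>T * (S\<^sup>T * F)"
    using transpose_mult[OF mult_carrier_mat[OF Ft S] F] transpose_mult[OF Ft S] by (simp add: sym)
  also have "\<dots> = F\<^sup>T * S * F" using assoc_mult_mat[OF Ft S F] by (simp add: sym)
  finally show ?thesis .
qed

lemma scalar_prod_sandwich_adjoint:
  fixes S :: "'a :: comm_semiring_0 mat"
  assumes F: "F \<in> carrier_mat k l" and S: "S \<in> carrier_mat k k" and G: "G \<in> carrier_mat k n"
    and z: "z \<in> carrier_vec l" and u: "u \<in> carrier_vec n"
  shows "z \<bullet> ((F\<^sup>T * S * G) *\<^sub>v u) = ((G\<^sup>T * S\<^sup>T * F) *\<^sub>v z) \<bullet> u"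
proof -
  have Ft: "F\<^sup>T \<in> carrier_mat l k" and Gt: "G\<^sup>T \<in> carrier_mat n k"
    and St: "S\<^sup>T \<in> carrier_mat k k" using F S G by auto
  have FS: "F\<^sup>T * S \<in> carrier_mat l k" by (rule mult_carrier_mat[OF Ft S])
  have "(F\<^sup>T * S * G)\<^sup>T = G\<^sup>T * (S\<^sup>T * F)"
    using transpose_mult[OF FS G] transpose_mult[OF Ft S] by simp
  also have "\<dots> = G\<^sup>T * S\<^sup>T * F" by (rule assoc_mult_mat[OF Gt St F, symmetric])
  finally show ?thesis
    using transpose_vec_mult_scalar[OF mult_carrier_mat[OF FS G] u z] by simp
qed

theorem lemma5:
  fixes n m p T Tini N :: nat
    and A B C D Q R Up Uf Yp Yf Kp Kf QQ RR :: "real mat"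
    and ud yd uini yini :: "nat \<Rightarrow> real vec"
    and zini ustar :: "real vec"
    and J :: "real vec \<Rightarrow> real"
  assumes sys: "is_lti_system n m p A B C D"
    and data: "is_io_trajectory A B C D T ud yd"
    and ini: "is_io_trajectory A B C D Tini uini yini"
    and zini: "zini = stack_signal m Tini uini @\<^sub>v stack_signal p Tini yini"
    and len: "Tini + N \<le> T"
    and Up: "Up \<in> carrier_mat (m * Tini) (T - (Tini + N) + 1)"
    and Uf: "Uf \<in> carrier_mat (m * N) (T - (Tini + N) + 1)"
    and U: "Up @\<^sub>r Uf = hankel m (Tini + N) T ud"
    and Yp: "Yp \<in> carrier_mat (p * Tini) (T - (Tini + N) + 1)"
    and Yf: "Yf \<in> carrier_mat (p * N) (T - (Tini + N) + 1)"
    and Y: "Yp @\<^sub>r Yf = hankel p (Tini + N) T yd"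
    and Kp: "Kp \<in> carrier_mat (p * N) ((m + p) * Tini)"
    and Kf: "Kf \<in> carrier_mat (p * N) (m * N)"
    and K: "Kp @\<^sub>c Kf = Yf * pinv (Up @\<^sub>r Yp @\<^sub>r Uf)"
    and Q: "sym_pos_def p Q"
    and R: "sym_pos_def m R"
    and QQ: "QQ = diag_block_mat (replicate N Q)"
    and RR: "RR = diag_block_mat (replicate N R)"
    and J: "\<And>u. J u = zini \<bullet> ((Kp\<^sup>T * QQ * Kp) *\<^sub>v zini)
                     + 2 * (zini \<bullet> ((Kp\<^sup>T * QQ * Kf) *\<^sub>v u))
                     + u \<bullet> ((Kf\<^sup>T * QQ * Kf + RR) *\<^sub>v u)"
    and opt: "is_arg_min J (\<lambda>u. u \<in> carrier_vec (m * N)) ustar"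
  shows "(Kf\<^sup>T * QQ * Kf + RR) *\<^sub>v ustar + (Kf\<^sup>T * QQ\<^sup>T * Kp) *\<^sub>v zini = 0\<^sub>v (m * N)"
proof -
  let ?M = "Kf\<^sup>T * QQ * Kf + RR" and ?g = "(Kf\<^sup>T * QQ\<^sup>T * Kp) *\<^sub>v zini"
  have QQ_carrier: "QQ \<in> carrier_mat (p * N) (p * N)" and RR_carrier: "RR \<in> carrier_mat (m * N) (m * N)"
    using Q R by (auto simp: QQ RR sym_pos_def_def intro: diag_block_mat_replicate_carrier)
  have QQ_sym: "QQ\<^sup>T = QQ" and RR_sym: "RR\<^sup>T = RR"
    unfolding QQ RR using Q R by (auto simp: sym_pos_def_def intro!: diag_block_mat_symmetric)
  have zini_carrier: "zini \<in> carrier_vec ((m + p) * Tini)"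
    unfolding zini stack_signal_def add_mult_distrib
    by (intro append_carrier_vec vec_carrier)
  have KQK: "Kf\<^sup>T * QQ * Kf \<in> carrier_mat (m * N) (m * N)"
    using mult_carrier_mat[OF mult_carrier_mat[OF _ QQ_carrier] Kf] Kf by simp
  show ?thesis
  proof (rule quadratic_minimizer_stationary[OF _ _ _ _ opt])
    show "?M \<in> carrier_mat (m * N) (m * N)" using KQK RR_carrier by simp
    show "?M\<^sup>T = ?M"
      by (simp only: transpose_add[OF KQK RR_carrier] congruence_symmetric[OF QQ_carrier QQ_sym Kf] RR_sym)
    show "?g \<in> carrier_vec (m * N)"
      using Kf by (intro carrier_vecI) simp
    show "J u = zini \<bullet> ((Kp\<^sup>T * QQ * Kp) *\<^sub>v zini) + 2 * (?g \<bullet> u) + u \<bullet> (?M *\<^sub>v u)"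
      if "u \<in> carrier_vec (m * N)" for u
      by (simp only: J scalar_prod_sandwich_adjoint[OF Kp QQ_carrier Kf zini_carrier that])
  qed
qed

end
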